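(* Let $0<a_1<a_2<\cdots<a_N$ be real numbers and let $m_1\ge m_2\ge\cdots\ge m_N\ge 1$ be integers. Let $Y_1,\dots,Y_N$ be independent random variables with $Y_i\sim\mathrm{Binomial}(m_i,\tfrac12)$. Then $$a_1Y_1+a_2Y_2+\cdots+a_NY_N \prec Y_1+2Y_2+\cdots+NY_N.$$
   Context: For random variables $X,Y$ with finite support, let $p_X^{[i]}$ denote the $i$-th largest value of the probability mass function of $X$ (counted with multiplicity, padded with zeros). Then $X\prec Y$ ($X$ is majorized by $Y$) means $\sum_{i=1}^k p_X^{[i]}\le\sum_{i=1}^k p_Y^{[i]}$ for every $k\ge1$ (the total sums both being $1$). *)

theory Defs
  imports "HOL-Probability.Probability"
begin

definition prob_mass :: "'a measure \<Rightarrow> ('a \<Rightarrow> real) \<Rightarrow> real \<Rightarrow> real" where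
  "prob_mass M X x = measure M {\<omega> \<in> space M. X \<omega> = x}"

(* The support is understood almost surely: values attained only on null sets do not count. *)
definition finitely_supported :: "'a measure \<Rightarrow> ('a \<Rightarrow> real) \<Rightarrow> bool" where
  "finitely_supported M X \<longleftrightarrow>
     X \<in> borel_measurable M \<and> (\<exists>S. finite S \<and> (AE \<omega> in M. X \<omega> \<in> S))"

(* The multiset has one entry per support point, so equal masses are repeated.
   For X without finite support, mset_set may return the empty multiset; majorized excludes this. *)
definition decreasing_masses :: "'a measure \<Rightarrow> ('a \<Rightarrow> real) \<Rightarrow> real list" where
  "decreasing_masses M X =
     rev (sorted_list_of_multiset
       (image_mset (prob_mass M X) (mset_set {x. prob_mass M X x \<noteq> 0})))"

(* Indexed from 1: the argument i stands for the i-th largest value. *)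
definition nth_largest_mass :: "'a measure \<Rightarrow> ('a \<Rightarrow> real) \<Rightarrow> nat \<Rightarrow> real" where
  "nth_largest_mass M X i =
     (if 1 \<le> i \<and> i \<le> length (decreasing_masses M X)
      then decreasing_masses M X ! (i - 1) else 0)"

(* X on M is majorized by Z on M'. *)
definition majorized ::
  "'a measure \<Rightarrow> ('a \<Rightarrow> real) \<Rightarrow> 'b measure \<Rightarrow> ('b \<Rightarrow> real) \<Rightarrow> bool" where
  "majorized M X M' Z \<longleftrightarrow>
     finitely_supported M X \<and> finitely_supported M' Z \<and>
     (\<forall>k\<ge>1. (\<Sum>i=1..k. nth_largest_mass M X i) \<le> (\<Sum>i=1..k. nth_largest_mass M' Z i))"

end

theory Submission
  imports Defs "HOL-Analysis.Finite_Function_Topology"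
begin

text \<open>
  Let $E$ be the Young diagram with rows of length $m_1 \ge m_2 \ge \dots \ge m_N$. Up to the factor
  $2^{-|E|}$, the mass of $\sum f_i Y_i$ at $x$ counts the subsets $A \subseteq E$ in which the row
  indices, weighted by $f$, add up to $x$. The real vector space on these subsets carries an
  action of $sl_2$: the raising operator $X$ moves a cell of $A$ from row $i$ to row $i+1$ within its
  column, or adds a cell in row 1 (a tensor product over the columns of Proctor's representations on
  $M(n)$). It raises the rank $\sum i$ by one and strictly increases the weight $\sum a_i$.
  Therefore the image of $X^k$ contains many independent vectors by $sl_2$ theory (all but the
  dimension of $k$ middle ranks), while it is spanned by as many vectors as there are subsets
  avoiding $k$ given weights. So $k$ weight levels contain no more subsets than $k$ middle ranks.
\<close>

section \<open>Representations of $sl_2$\<close>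

text \<open>The third generator of sl_2 acts on \<open>U r\<close> as the scalar
  \<open>2 * r - D\<close>, so \<open>D\<close> is twice the middle degree. The bounds
  \<open>lo\<close> and \<open>hi\<close> let inductions on the degree start from either
  end.\<close>

locale sl2_graded =
  fixes X Y :: "'v::real_vector \<Rightarrow> 'v" and U :: "int \<Rightarrow> 'v set" and D lo hi :: int
  assumes linX: "linear X" and linY: "linear Y"
    and X_U: "v \<in> U r \<Longrightarrow> X v \<in> U (r + 1)"
    and Y_U: "v \<in> U r \<Longrightarrow> Y v \<in> U (r - 1)"
    and commutator: "v \<in> U r \<Longrightarrow> X (Y v) - Y (X v) = of_int (2 * r - D) *\<^sub>R v"
    and subspace_U: "subspace (U r)"
    and U_below: "r < lo \<Longrightarrow> U r \<subseteq> {0}"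
    and U_above: "hi < r \<Longrightarrow> U r \<subseteq> {0}"
begin

lemma linear_X_pow: "linear (X ^^ k)"
proof (induction k)
  case 0
  show ?case by (simp add: linear_id[unfolded id_def] id_def)
next
  case (Suc k)
  show ?case using linear_compose[OF Suc linX] by (simp add: comp_def)
qed

lemma X_pow_U: "v \<in> U r \<Longrightarrow> (X ^^ k) v \<in> U (r + int k)"
proof (induction k)
  case (Suc k)
  then show ?case using X_U[of "(X ^^ k) v" "r + int k"] by (simp add: ac_simps)
qed simp

text \<open>Moving \<open>Y\<close> past the copies of \<open>X\<close> one at a time contributes
  \<open>D - 2 * (r + i)\<close> for each i from 0 to k; the coefficient is the sum of these
  terms.\<close>

lemma Y_X_pow:
  assumes "v \<in> U r"
  shows "Y ((X ^^ Suc k) v) =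
    (X ^^ Suc k) (Y v) + of_int ((int k + 1) * (D - 2 * r - int k)) *\<^sub>R (X ^^ k) v"
proof (induction k)
  case 0
  show ?case using commutator[OF assms] by (simp add: algebra_simps)
next
  case (Suc k)
  let ?u = "(X ^^ Suc k) v"
  have "?u \<in> U (r + int (Suc k))" by (rule X_pow_U[OF assms])
  from commutator[OF this]
  have "Y (X ?u) = X (Y ?u) - of_int (2 * (r + int (Suc k)) - D) *\<^sub>R ?u"
    by (simp add: algebra_simps)
  also have "X (Y ?u) = (X ^^ Suc (Suc k)) (Y v) + of_int ((int k + 1) * (D - 2 * r - int k)) *\<^sub>R ?u"
    unfolding Suc by (simp add: linear_add[OF linX] linear_scale[OF linX])
  finally have "Y (X ?u) = (X ^^ Suc (Suc k)) (Y v) + (of_int ((int k + 1) * (D - 2 * r - int k))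
      - of_int (2 * (r + int (Suc k)) - D)) *\<^sub>R ?u"
    by (simp only: scaleR_diff_left add_diff_eq)
  also have "of_int ((int k + 1) * (D - 2 * r - int k)) - of_int (2 * (r + int (Suc k)) - D)
      = (of_int ((int (Suc k) + 1) * (D - 2 * r - int (Suc k))) :: real)"
    by (simp add: algebra_simps)
  finally show ?case by simp
qed

text \<open>If $X^k v = 0$, then $X^{k+1} Y v = 0$ by the commutator formula, so $Y v = 0$ by induction on
  the degree, and the same formula leaves $X^{k-1} v = 0$.\<close>

lemma X_pow_eq_0:
  assumes "v \<in> U r" "2 * r + int k \<le> D" "(X ^^ k) v = 0"
  shows "v = 0"
  using assms
proof (induction "nat (r + 1 - lo)" arbitrary: r k v)
  case 0
  then show ?case using U_below[of r] by auto
next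
  case (Suc n)
  note IH = Suc.hyps(1) and n = Suc.hyps(2)
  show ?case using Suc.prems
  proof (induction k)
    case 0
    then show ?case by simp
  next
    case (Suc k)
    have eq: "(X ^^ Suc k) (Y v) + of_int ((int k + 1) * (D - 2 * r - int k)) *\<^sub>R (X ^^ k) v = 0"
      using Y_X_pow[OF Suc.prems(1), of k] Suc.prems(3) by (simp add: linear_0[OF linY])
    have "X ((X ^^ Suc k) (Y v)) + of_int ((int k + 1) * (D - 2 * r - int k)) *\<^sub>R (X ^^ Suc k) v = 0"
      using arg_cong[OF eq, of X] by (simp add: linear_add[OF linX] linear_scale[OF linX] linear_0[OF linX])
    then have "(X ^^ Suc (Suc k)) (Y v) = 0"
      using Suc.prems(3) by simp
    moreover have "n = nat (r - 1 + 1 - lo)" using n by simp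
    \<comment> \<open>Going down one degree pays for one more power of \<open>X\<close>: 2(r - 1) +
      (k + 2) = 2r + k \<le> D.\<close>
    ultimately have "Y v = 0"
      using IH[of "r - 1" "Y v" "Suc (Suc k)"] Y_U[OF Suc.prems(1)] Suc.prems(2) by simp
    then have "of_int ((int k + 1) * (D - 2 * r - int k)) *\<^sub>R (X ^^ k) v = 0"
      using eq by (simp add: linear_0[OF linear_X_pow] linear_0[OF linX])
    moreover have "(int k + 1) * (D - 2 * r - int k) \<noteq> 0"
      using Suc.prems(2) by auto
    ultimately have "(X ^^ k) v = 0" unfolding scaleR_eq_0_iff of_int_eq_0_iff by blast
    then show ?case using Suc.IH Suc.prems by simp
  qed
qed

text \<open>Counterpart of \<open>X_pow_eq_0\<close> above the middle, by induction from the top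
  degree downwards and, inside it, on the power. Comparing two expressions for
  \<open>Y (X v)\<close> turns a preimage under \<open>X ^^ k\<close> into one under
  \<open>X ^^ Suc k\<close>.\<close>

lemma X_pow_surj:
  assumes "v \<in> U s" "D \<le> 2 * s - int k"
  shows "\<exists>u \<in> U (s - int k). (X ^^ k) u = v"
  using assms
proof (induction "nat (hi + 1 - s)" arbitrary: s k v)
  case 0
  then have "v = 0" using U_above[of s] by auto
  then show ?case using subspace_0[OF subspace_U] linear_0[OF linear_X_pow] by blast
next
  case (Suc n)
  note IH = Suc.hyps(1) and n = Suc.hyps(2)
  show ?case using Suc.prems
  proof (induction k)
    case 0
    then show ?case by auto
  next
    case (Suc k)
    then obtain u where u: "u \<in> U (s - int k)" "(X ^^ k) u = v" by auto
    define c where "c = (int k + 1) * (D - 2 * (s - int k) - int k)"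
    have "(X ^^ Suc k) u \<in> U (s + 1)" using X_U[OF Suc.prems(1)] u by simp
    \<comment> \<open>\<open>X v\<close> sits one degree higher, where the outer induction
      hypothesis allows the power k + 2.\<close>
    then obtain z where z: "z \<in> U (s - int (Suc k))" "(X ^^ Suc (Suc k)) z = (X ^^ Suc k) u"
      using IH[of "s + 1" "(X ^^ Suc k) u" "Suc (Suc k)"] n Suc.prems(2)
      by (fastforce simp: algebra_simps)
    define d where "d = (int (Suc k) + 1) * (D - 2 * (s - int (Suc k)) - int (Suc k))"
    have "Y ((X ^^ Suc k) u) = (X ^^ Suc (Suc k)) (Y z) + of_int d *\<^sub>R (X ^^ Suc k) z"
      unfolding z(2)[symmetric] d_def by (rule Y_X_pow[OF z(1)])
    then have "(X ^^ Suc k) (Y u) + of_int c *\<^sub>R v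
        = (X ^^ Suc k) (X (Y z)) + of_int d *\<^sub>R (X ^^ Suc k) z"
      using Y_X_pow[OF u(1), of k] u(2) by (simp add: c_def funpow_swap1)
    \<comment> \<open>Every term except the multiple of \<open>v\<close> by \<open>c\<close> is an
      image under \<open>X ^^ Suc k\<close>.\<close>
    then have main: "of_int c *\<^sub>R v = (X ^^ Suc k) (X (Y z) + of_int d *\<^sub>R z - Y u)"
      by (simp only: linear_add[OF linear_X_pow] linear_diff[OF linear_X_pow] linear_scale[OF linear_X_pow])
         (simp add: algebra_simps)
    \<comment> \<open>The bound D \<le> 2s - (k + 1) makes the second factor of \<open>c\<close>
      negative.\<close>
    have "c \<noteq> 0" using Suc.prems(2) by (auto simp: c_def)
    then have v: "v = (X ^^ Suc k) ((1 / of_int c) *\<^sub>R (X (Y z) + of_int d *\<^sub>R z - Y u))"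
      unfolding linear_scale[OF linear_X_pow] main[symmetric] by simp
    have "X (Y z) + of_int d *\<^sub>R z - Y u \<in> U (s - int (Suc k))"
      using z(1) u(1) X_U[OF Y_U[OF z(1)]] Y_U[OF u(1)]
      by (intro subspace_diff subspace_add subspace_scale subspace_U) (simp_all add: algebra_simps)
    then show ?case by (intro bexI[where x = "(1 / of_int c) *\<^sub>R (X (Y z) + of_int d *\<^sub>R z - Y u)"]
        v[symmetric] subspace_scale[OF subspace_U])
  qed
qed

end

section \<open>Linear algebra of spans and independent sets\<close>

lemma span_Int_disjoint_independent:
  fixes B :: "'v::real_vector set"
  assumes "independent (A \<union> B)" "A \<inter> B = {}" "v \<in> span A" "v \<in> span B"
  shows "v = 0"
proof -
  have A: "independent A" and B: "independent B"
    using assms(1) independent_mono by blast+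
  \<comment> \<open>The coordinates of \<open>v\<close> with respect to \<open>A \<union> B\<close>
    are supported both in \<open>A\<close> and in \<open>B\<close>, hence nowhere.\<close>
  have "representation (A \<union> B) v = representation A v"
    using representation_extend[OF assms(1) assms(3)] by auto
  moreover have "representation (A \<union> B) v = representation B v"
    using representation_extend[OF assms(1) assms(4)] by auto
  ultimately have "representation A v b = 0" for b
    by (metis IntI assms(2) empty_iff representation_ne_zero)
  then show ?thesis
    using real_vector.sum_nonzero_representation_eq[OF A assms(3)] by simp
qed

text \<open>In a vanishing combination the part from \<open>A\<close> is the negative of the part
  from \<open>B\<close>, so each lies in both spans and is zero.\<close>

lemma independent_Un_direct:
  fixes A B :: "'v::real_vector set"
  assumes A: "finite A" "independent A" and B: "finite B" "independent B"
    and direct: "\<And>v. v \<in> span A \<Longrightarrow> v \<in> span B \<Longrightarrow> v = 0"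
  shows "independent (A \<union> B)" "A \<inter> B = {}"
proof -
  show disj: "A \<inter> B = {}"
  proof (rule ccontr)
    assume "A \<inter> B \<noteq> {}"
    then obtain v where "v \<in> A" "v \<in> B" by blast
    then have "v = 0" using direct span_base by blast
    then show False using \<open>v \<in> A\<close> A(2) dependent_zero by blast
  qed
  show "independent (A \<union> B)"
  proof (rule independent_if_scalars_zero)
    fix f x assume 0: "(\<Sum>x\<in>A \<union> B. f x *\<^sub>R x) = 0" and x: "x \<in> A \<union> B"
    define a where "a = (\<Sum>x\<in>A. f x *\<^sub>R x)"
    define b where "b = (\<Sum>x\<in>B. f x *\<^sub>R x)"
    have "a + b = 0" using 0 A B disj by (simp add: a_def b_def sum.union_disjoint)
    moreover have "a \<in> span A" "b \<in> span B"
      unfolding a_def b_def by (intro span_sum span_scale span_base; assumption)+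
    ultimately have "a = 0"
      using direct[of a] span_neg[of b B] by (simp add: eq_neg_iff_add_eq_0[symmetric])
    then have "b = 0" using \<open>a + b = 0\<close> by simp
    then show "f x = 0"
      using x \<open>a = 0\<close> independentD[OF A(2,1) order_refl, of f x]
        independentD[OF B(2,1) order_refl, of f x]
      unfolding a_def b_def by blast
  qed (use A B in auto)
qed

lemma linear_span_subset:
  assumes "linear f" "\<And>b. b \<in> B \<Longrightarrow> f b \<in> span C" "v \<in> span B"
  shows "f v \<in> span C"
proof -
  have "f ` span B = span (f ` B)" using assms(1) by (simp add: linear_span_image)
  also have "\<dots> \<subseteq> span C" using assms(2) by (intro span_minimal subspace_span) auto
  finally show ?thesis using assms(3) by auto
qed

text \<open>The setting of the counting argument: \<open>P\<close> indexes a homogeneous basis, and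
  \<open>X\<close> raises a second statistic \<open>w\<close> along with the rank. All relations are
  asked on basis vectors only.\<close>

locale ranked_sl2 =
  fixes P :: "'c set" and e :: "'c \<Rightarrow> 'v::real_vector" and rk :: "'c \<Rightarrow> int" and w :: "'c \<Rightarrow> real"
    and X Y :: "'v \<Rightarrow> 'v" and D :: int
  assumes finite_P: "finite P" and inj_e: "inj_on e P" and indep_e: "independent (e ` P)"
    and linX: "linear X" and linY: "linear Y"
    and X_e: "c \<in> P \<Longrightarrow> X (e c) \<in> span (e ` {d \<in> P. rk d = rk c + 1 \<and> w c < w d})"
    and Y_e: "c \<in> P \<Longrightarrow> Y (e c) \<in> span (e ` {d \<in> P. rk d = rk c - 1})"
    and commutator_e: "c \<in> P \<Longrightarrow> X (Y (e c)) - Y (X (e c)) = of_int (2 * rk c - D) *\<^sub>R e c"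
begin

definition U :: "int \<Rightarrow> 'v set" where
  "U r = span (e ` {c \<in> P. rk c = r})"

lemma span_disjoint:
  assumes "v \<in> span (e ` C1)" "v \<in> span (e ` C2)" "C1 \<subseteq> P" "C2 \<subseteq> P" "C1 \<inter> C2 = {}"
  shows "v = 0"
proof (rule span_Int_disjoint_independent)
  show "independent (e ` C1 \<union> e ` C2)"
    by (rule independent_mono[OF indep_e]) (use assms in auto)
  show "e ` C1 \<inter> e ` C2 = {}"
    using inj_on_image_Int[OF inj_e assms(3,4)] assms(5) by simp
qed (use assms in auto)

text \<open>\<open>insert 0\<close> keeps \<open>Min\<close> and \<open>Max\<close> meaningful for
  empty \<open>P\<close>. Beyond these bounds no basis vector has the given rank.\<close>

sublocale sl2_graded X Y U D "Min (insert 0 (rk ` P))" "Max (insert 0 (rk ` P))"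
proof (rule sl2_graded.intro)
  show "linear X" "linear Y" by (rule linX, rule linY)
  show "subspace (U r)" for r by (simp add: U_def)
  show "X v \<in> U (r + 1)" if "v \<in> U r" for v r
    using that unfolding U_def
    by (rule linear_span_subset[OF linX, rotated])
       (auto intro!: subsetD[OF span_mono X_e])
  show "Y v \<in> U (r - 1)" if "v \<in> U r" for v r
    using that unfolding U_def
    by (rule linear_span_subset[OF linY, rotated])
       (auto intro!: subsetD[OF span_mono Y_e])
  show "X (Y v) - Y (X v) = real_of_int (2 * r - D) *\<^sub>R v" if "v \<in> U r" for v r
  proof -
    have "linear (\<lambda>v. X (Y v) - Y (X v))" "linear (\<lambda>v. real_of_int (2 * r - D) *\<^sub>R v)"
      using linear_compose[OF linX linY] linear_compose[OF linY linX]
      by (auto simp: comp_def intro: linear_compose_sub linear_compose_scale_right linear_ident)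
    then show ?thesis
      using that unfolding U_def by (rule linear_eq_on) (use commutator_e in auto)
  qed
  show "U r \<subseteq> {0}" if "r < Min (insert 0 (rk ` P))" for r
  proof -
    have "{c \<in> P. rk c = r} = {}" using that finite_P by auto
    then show ?thesis unfolding U_def by (simp only: image_empty span_empty order_refl)
  qed
  show "U r \<subseteq> {0}" if "Max (insert 0 (rk ` P)) < r" for r
  proof -
    have "{c \<in> P. rk c = r} = {}" using that finite_P by auto
    then show ?thesis unfolding U_def by (simp only: image_empty span_empty order_refl)
  qed
qed

lemma U_top: "c \<in> P \<Longrightarrow> e c \<in> U (rk c)"
  unfolding U_def by (auto intro: span_base)

lemma U_subset: "U r \<subseteq> span (e ` P)"
  unfolding U_def by (intro span_mono) auto

text \<open>Extends \<open>X_pow_eq_0\<close> to sums over several ranks: components of different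
  ranks have images of different ranks, so each component is killed separately.\<close>

lemma X_pow_kernel:
  assumes "finite J" "\<And>r. r \<in> J \<Longrightarrow> 2 * r + int k \<le> D"
    and "v \<in> span (e ` {c \<in> P. rk c \<in> J})" "(X ^^ k) v = 0"
  shows "v = 0"
  using assms
proof (induction J arbitrary: v)
  case empty
  then show ?case by simp
next
  case (insert r J)
  have "{c \<in> P. rk c \<in> insert r J} = {c \<in> P. rk c = r} \<union> {c \<in> P. rk c \<in> J}" by auto
  with insert.prems(2) obtain y z where yz: "v = y + z" "y \<in> U r"
      "z \<in> span (e ` {c \<in> P. rk c \<in> J})"
    by (auto simp: image_Un span_Un U_def)
  have "(X ^^ k) z \<in> span (e ` {c \<in> P. rk c \<in> (\<lambda>r. r + int k) ` J})"
    using yz(3)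
    by (rule linear_span_subset[OF linear_X_pow, rotated])
       (auto intro!: subsetD[OF span_mono X_pow_U[OF U_top, unfolded U_def]])
  moreover have y: "(X ^^ k) y \<in> span (e ` {c \<in> P. rk c = r + int k})"
    using X_pow_U[OF yz(2)] by (simp add: U_def)
  moreover have sum0: "(X ^^ k) y + (X ^^ k) z = 0"
    using insert.prems(3) by (simp add: yz linear_add[OF linear_X_pow])
  then have "(X ^^ k) z = - (X ^^ k) y" by (simp add: add_eq_0_iff)
  \<comment> \<open>This vector lies in the span for rank \<open>r + int k\<close> and, as
    \<open>r\<close> is not in \<open>J\<close>, also in a span for other ranks.\<close>
  ultimately have "(X ^^ k) z = 0"
    using insert.hyps(2) by (intro span_disjoint[OF _ span_neg[OF y, folded \<open>(X ^^ k) z = _\<close>]]) auto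
  then have "(X ^^ k) y = 0" using sum0 by simp
  then have "y = 0" using X_pow_eq_0[OF yz(2), of k] insert.prems(1)[of r] by simp
  moreover have "z = 0" using insert.IH[OF _ yz(3) \<open>(X ^^ k) z = 0\<close>] insert.prems(1) by simp
  ultimately show ?case by (simp add: yz)
qed

text \<open>\<open>lower\<close> makes \<open>X ^^ k\<close> injective on ranks below
  \<open>t\<close>, with images in ranks below \<open>t + int k\<close>; \<open>upper\<close> puts
  every basis vector of rank at least \<open>t + int k\<close> into the image. The two families are
  jointly independent and omit exactly k ranks.\<close>

lemma X_pow_large_image:
  assumes lower: "2 * (t - 1) + int k \<le> D" and upper: "D \<le> 2 * t + int k"
  shows "\<exists>B. finite B \<and> independent B \<and> B \<subseteq> (X ^^ k) ` span (e ` P) \<and>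
    card B = card {c \<in> P. rk c < t \<or> t + int k \<le> rk c}"
proof -
  define L where "L = {c \<in> P. rk c < t}"
  define R where "R = {c \<in> P. t + int k \<le> rk c}"
  have fin: "finite L" "finite R" using finite_P by (auto simp: L_def R_def)
  have sub: "L \<subseteq> P" "R \<subseteq> P" by (auto simp: L_def R_def)
  have ker: "v = 0" if "v \<in> span (e ` L)" "(X ^^ k) v = 0" for v
  proof (rule X_pow_kernel[of "rk ` L"])
    show "v \<in> span (e ` {c \<in> P. rk c \<in> rk ` L})"
      by (rule subsetD[OF span_mono that(1)]) (auto simp: L_def)
  qed (use fin lower that in \<open>auto simp: L_def\<close>)
  have inj: "inj_on (X ^^ k) (span (e ` L))"
    using ker by (subst linear_inj_on_iff_eq_0[OF linear_X_pow subspace_span]) auto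
  have indL: "independent (e ` L)" and indR: "independent (e ` R)"
    by (rule independent_mono[OF indep_e image_mono[OF sub(1)]],
        rule independent_mono[OF indep_e image_mono[OF sub(2)]])
  define A where "A = (X ^^ k) ` e ` L"
  have indA: "independent A"
    unfolding A_def by (rule linear_independent_injective_image[OF linear_X_pow indL inj])
  have cardA: "card A = card L"
    unfolding A_def
    using card_image[OF inj_on_subset[OF inj span_superset]] card_image[OF inj_on_subset[OF inj_e sub(1)]]
    by simp
  have cardR: "card (e ` R) = card R"
    by (rule card_image[OF inj_on_subset[OF inj_e sub(2)]])
  have spanA: "span A \<subseteq> span (e ` {c \<in> P. rk c < t + int k})"
    unfolding A_def L_def
    by (intro span_minimal subspace_span)
       (auto intro!: subsetD[OF span_mono X_pow_U[OF U_top, unfolded U_def]])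
  have direct: "v = 0" if "v \<in> span A" "v \<in> span (e ` R)" for v
    by (rule span_disjoint[OF subsetD[OF spanA that(1)] that(2)]) (auto simp: R_def)
  have "e c \<in> (X ^^ k) ` span (e ` P)" if c: "c \<in> R" for c
  proof -
    have "\<exists>u \<in> U (rk c - int k). (X ^^ k) u = e c"
      using c upper by (intro X_pow_surj U_top) (auto simp: R_def)
    then obtain u where "u \<in> span (e ` P)" "e c = (X ^^ k) u" using U_subset by force
    then show ?thesis by (rule rev_image_eqI)
  qed
  moreover have "e ` L \<subseteq> span (e ` P)"
    using order_trans[OF image_mono[OF sub(1)] span_superset] .
  then have "A \<subseteq> (X ^^ k) ` span (e ` P)"
    unfolding A_def by (rule image_mono)
  ultimately have image: "A \<union> e ` R \<subseteq> (X ^^ k) ` span (e ` P)" by blast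
  have finA: "finite A" "finite (e ` R)" using fin by (simp_all add: A_def)
  note Un = independent_Un_direct[OF finA(1) indA finA(2) indR direct]
  have "L \<inter> R = {}" by (auto simp: L_def R_def)
  then have "card (A \<union> e ` R) = card (L \<union> R)"
    using Un(2) by (simp add: card_Un_disjoint fin finA cardA cardR)
  moreover have "L \<union> R = {c \<in> P. rk c < t \<or> t + int k \<le> rk c}"
    unfolding L_def R_def by blast
  ultimately have "card (A \<union> e ` R) = card {c \<in> P. rk c < t \<or> t + int k \<le> rk c}" by simp
  then show ?thesis
    using Un(1) finA image by (intro exI[of _ "A \<union> e ` R"] conjI finite_UnI)
qed

text \<open>A basis vector whose weight lies below $s = \min S$ contributes one spanning vector. Those of
  weight at least $s$ are mapped by $X$ strictly above $s$, so the level $s$ costs one power of $X$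
  but no spanning vector.\<close>

lemma X_pow_small_image:
  assumes "finite S" "\<And>s. s \<in> S \<Longrightarrow> t < s"
  shows "\<exists>F. finite F \<and> card F \<le> card {c \<in> P. t < w c \<and> w c \<notin> S} \<and>
    (\<forall>v \<in> span (e ` {c \<in> P. t < w c}). (X ^^ card S) v \<in> span F)"
  using assms
proof (induction "card S" arbitrary: S t)
  case 0
  let ?Q = "{c \<in> P. t < w c}"
  show ?case
    using finite_P 0 by (intro exI[of _ "e ` ?Q"]) (simp add: card_image_le)
next
  case (Suc n)
  define s where "s = Min S"
  have "S \<noteq> {}" using Suc.hyps(2) by auto
  then have s: "s \<in> S" "\<And>x. x \<in> S \<Longrightarrow> s \<le> x"
    unfolding s_def using Suc.prems(1) by simp_all
  have n: "n = card (S - {s})"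
    using Suc.hyps(2) s(1) by (simp flip: \<open>Suc n = card S\<close>)
  \<comment> \<open>The remaining levels are treated with \<open>s\<close> as the new
    threshold.\<close>
  obtain F where F: "finite F" "card F \<le> card {c \<in> P. s < w c \<and> w c \<notin> S - {s}}"
      "\<And>v. v \<in> span (e ` {c \<in> P. s < w c}) \<Longrightarrow> (X ^^ n) v \<in> span F"
  proof -
    have "s < x" if "x \<in> S - {s}" for x using s(2)[of x] that by auto
    from Suc.hyps(1)[OF n _ this] Suc.prems(1) that show thesis
      unfolding n[symmetric] by blast
  qed
  define C where "C = {c \<in> P. t < w c \<and> w c < s}"
  define G where "G = (\<lambda>c. (X ^^ Suc n) (e c)) ` C"
  have "finite C" using finite_P by (simp add: C_def)
  have "card (G \<union> F) \<le> card C + card F"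
    using card_Un_le[of G F] card_image_le[OF \<open>finite C\<close>, of "\<lambda>c. (X ^^ Suc n) (e c)"]
    unfolding G_def by linarith
  also have "\<dots> \<le> card C + card {c \<in> P. s < w c \<and> w c \<notin> S - {s}}"
    using F(2) by simp
  also have "\<dots> = card (C \<union> {c \<in> P. s < w c \<and> w c \<notin> S - {s}})"
    using finite_P by (intro card_Un_disjoint[symmetric]) (auto simp: C_def)
  \<comment> \<open>Weight exactly \<open>s\<close> occurs in neither set, and weights between
    \<open>t\<close> and \<open>s\<close> avoid \<open>S\<close> because \<open>s\<close> is its
    minimum.\<close>
  also have "\<dots> \<le> card {c \<in> P. t < w c \<and> w c \<notin> S}"
    using finite_P Suc.prems(2)[OF s(1)] s(2) by (intro card_mono) (force simp: C_def)+
  finally have card: "card (G \<union> F) \<le> card {c \<in> P. t < w c \<and> w c \<notin> S}" .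
  have "(X ^^ Suc n) (e c) \<in> span (G \<union> F)" if c: "c \<in> P" "t < w c" for c
  proof (cases "w c < s")
    case True
    then show ?thesis using c by (auto simp: G_def C_def intro!: span_base)
  next
    case False
    then have "X (e c) \<in> span (e ` {c \<in> P. s < w c})"
      by (intro subsetD[OF span_mono X_e[OF c(1)]]) auto
    then have "(X ^^ n) (X (e c)) \<in> span F" by (rule F(3))
    then show ?thesis
      using span_mono[of F "G \<union> F"] by (auto simp: funpow_swap1)
  qed
  then have "(X ^^ Suc n) b \<in> span (G \<union> F)" if "b \<in> e ` {c \<in> P. t < w c}" for b
    using that by blast
  note linear_span_subset[OF linear_X_pow this]
  moreover have "finite (G \<union> F)" using F(1) \<open>finite C\<close> by (simp add: G_def)
  ultimately show ?case
    using card unfolding \<open>Suc n = card S\<close>[symmetric]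
    by (intro exI[of _ "G \<union> F"] conjI ballI)
qed

text \<open>The image of \<open>X ^^ card S\<close> has dimension at least the number of elements
  outside the middle ranks and at most the number with weight outside \<open>S\<close>. Taking
  complements in \<open>P\<close> reverses the inequality.\<close>

lemma card_levels_le_card_middle_ranks:
  assumes "finite S"
  shows "\<exists>t. card {c \<in> P. w c \<in> S} \<le> card {c \<in> P. rk c \<in> {t..<t + int (card S)}}"
proof -
  define k where "k = card S"
  \<comment> \<open>The window of k ranks starting at \<open>t\<close> is centred at D/2 up to
    rounding.\<close>
  define t where "t = (D - int k) div 2 + 1"
  \<comment> \<open>Strictly below all weights and all of \<open>S\<close>, so the condition
    \<open>t0 < w c\<close> excludes nothing.\<close>
  define t0 where "t0 = Min (insert 0 (w ` P \<union> S)) - 1"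
  have t0: "t0 < x" if "x \<in> w ` P \<union> S" for x
  proof -
    have "Min (insert 0 (w ` P \<union> S)) \<le> x" using that finite_P assms by (intro Min_le) auto
    then show ?thesis by (simp only: t0_def)
  qed
  have "2 * (t - 1) + int k \<le> D" "D \<le> 2 * t + int k" unfolding t_def by simp_all
  from X_pow_large_image[OF this] obtain B where B: "independent B" "B \<subseteq> (X ^^ k) ` span (e ` P)"
      "card B = card {c \<in> P. rk c < t \<or> t + int k \<le> rk c}"
    by blast
  obtain F where F: "finite F" "card F \<le> card {c \<in> P. t0 < w c \<and> w c \<notin> S}"
      "\<And>v. v \<in> span (e ` {c \<in> P. t0 < w c}) \<Longrightarrow> (X ^^ k) v \<in> span F"
    using X_pow_small_image[OF assms, of t0] t0 unfolding k_def by blast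
  have P: "{c \<in> P. t0 < w c} = P" using t0 by auto
  have "card B \<le> card F"
    using independent_span_bound[OF F(1) B(1)] B(2) F(3) unfolding P by blast
  also have "\<dots> \<le> card {c \<in> P. w c \<notin> S}"
    using order_trans[OF F(2) card_mono[of "{c \<in> P. w c \<notin> S}"]] finite_P by auto
  finally have "card {c \<in> P. rk c < t \<or> t + int k \<le> rk c} \<le> card {c \<in> P. w c \<notin> S}"
    using B(3) by simp
  moreover have "card P = card {c \<in> P. rk c < t \<or> t + int k \<le> rk c} + card {c \<in> P. rk c \<in> {t..<t + int k}}"
    using finite_P by (subst card_Un_disjoint[symmetric]) (auto intro!: arg_cong[where f = card])
  moreover have "card P = card {c \<in> P. w c \<notin> S} + card {c \<in> P. w c \<in> S}"
    using finite_P by (subst card_Un_disjoint[symmetric]) (auto intro!: arg_cong[where f = card])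
  ultimately show ?thesis unfolding k_def by (intro exI[of _ t]) linarith
qed

end

section \<open>The action on subsets of a Young diagram\<close>

lemma lookup_scaleR:
  fixes v :: "'a \<Rightarrow>\<^sub>0 'b::real_vector"
  shows "Poly_Mapping.lookup (r *\<^sub>R v) i = r *\<^sub>R Poly_Mapping.lookup v i"
  by (simp add: scaleR_poly_mapping_def Abs_poly_mapping_inverse finite_subset[OF _ finite_lookup[of v]])

text \<open>The heights \<open>n j\<close> are arbitrary, as the action works within each column.
  The conditions on \<open>a\<close> concern the single moves: entering row 1, or passing to the
  next row of an existing column.\<close>

locale columns =
  fixes J :: "'j set" and n :: "'j \<Rightarrow> nat" and a :: "nat \<Rightarrow> real"
  assumes finite_J: "finite J"
    and a_pos: "j \<in> J \<Longrightarrow> 1 \<le> n j \<Longrightarrow> 0 < a 1"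
    and a_less: "j \<in> J \<Longrightarrow> 1 \<le> i \<Longrightarrow> i < n j \<Longrightarrow> a i < a (Suc i)"
begin

definition E :: "(nat \<times> 'j) set" where
  "E = {(i, j). j \<in> J \<and> 1 \<le> i \<and> i \<le> n j}"

text \<open>Generators: \<open>(j, i)\<close> is the move between rows \<open>i\<close> and
  \<open>Suc i\<close> of column \<open>j\<close>, column first, unlike in cells.\<close>

definition G :: "('j \<times> nat) set" where
  "G = (SIGMA j:J. {..<n j})"

text \<open>Position 0 is a virtual source: the generator $(j, 0)$ adds or removes the cell in row 1.\<close>

definition raise :: "'j \<times> nat \<Rightarrow> (nat \<times> 'j) set \<Rightarrow> (nat \<times> 'j) set option" where
  "raise = (\<lambda>(j, i) A. if (Suc i, j) \<notin> A \<and> (i = 0 \<or> (i, j) \<in> A)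
     then Some (insert (Suc i, j) (A - {(i, j)})) else None)"

definition lower :: "'j \<times> nat \<Rightarrow> (nat \<times> 'j) set \<Rightarrow> (nat \<times> 'j) set option" where
  "lower = (\<lambda>(j, i) A. if (Suc i, j) \<in> A \<and> (i = 0 \<or> (i, j) \<notin> A)
     then Some ((if i = 0 then id else insert (i, j)) (A - {(Suc i, j)})) else None)"

definition rank :: "(nat \<times> 'j) set \<Rightarrow> int" where
  "rank A = (\<Sum>(i, j)\<in>A. int i)"

definition weight :: "(nat \<times> 'j) set \<Rightarrow> real" where
  "weight A = (\<Sum>(i, j)\<in>A. a i)"

lemma finite_G: "finite G"
  using finite_J by (simp add: G_def)

lemma E_eq: "E = (\<lambda>(j, i). (i, j)) ` (SIGMA j:J. {1..n j})"
  by (auto simp: E_def image_iff)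

lemma finite_E: "finite E"
  using finite_J by (simp add: E_eq)

lemma zero_notin: "A \<subseteq> E \<Longrightarrow> (0, j) \<notin> A"
  by (auto simp: E_def)

text \<open>Moves without a common cell do not interact. Adjacent moves in one column compete for
  the shared cell: each leaves it in the state that blocks the other, so both composites are
  \<open>None\<close>.\<close>

lemma raise_lower_commute:
  assumes "p \<noteq> q" "A \<subseteq> E"
  shows "Option.bind (lower q A) (raise p) = Option.bind (raise p A) (lower q)"
proof -
  obtain j i j' i' where [simp]: "p = (j, i)" "q = (j', i')" by (metis surj_pair)
  have ne: "j \<noteq> j' \<or> i \<noteq> i'" using assms(1) by auto
  have [simp]: "(0, j) \<notin> A" for j using zero_notin[OF assms(2)] .
  show ?thesis
  proof (cases "j = j'")
    case False
    then show ?thesis by (auto simp: raise_def lower_def)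
  next
    case True
    then have "i \<noteq> i'" using ne by simp
    consider "i = Suc i'" | "i' = Suc i" | "i \<noteq> i'" "i \<noteq> Suc i'" "i' \<noteq> Suc i"
      using \<open>i \<noteq> i'\<close> by blast
    then show ?thesis
      using True by cases (auto simp: raise_def lower_def)
  qed
qed

lemma raise_lower:
  assumes "A \<subseteq> E"
  shows "Option.bind (lower (j, i) A) (raise (j, i)) =
    (if (Suc i, j) \<in> A \<and> (i = 0 \<or> (i, j) \<notin> A) then Some A else None)"
  using zero_notin[OF assms] by (auto simp: raise_def lower_def)

lemma lower_raise:
  assumes "A \<subseteq> E"
  shows "Option.bind (raise (j, i) A) (lower (j, i)) =
    (if (Suc i, j) \<notin> A \<and> (i = 0 \<or> (i, j) \<in> A) then Some A else None)"
  using zero_notin[OF assms] by (auto simp: raise_def lower_def)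

lemma raise_Some:
  assumes "p \<in> G" "A \<subseteq> E" "raise p A = Some B"
  shows "B \<subseteq> E" "rank B = rank A + 1" "weight A < weight B"
proof -
  obtain j i where p: "p = (j, i)" "j \<in> J" "i < n j" using assms(1) by (auto simp: G_def)
  have B: "B = insert (Suc i, j) (A - {(i, j)})" and A: "(Suc i, j) \<notin> A" "i = 0 \<or> (i, j) \<in> A"
    using assms(3) by (auto simp: raise_def p split: if_splits)
  have fin: "finite A" using finite_subset[OF assms(2) finite_E] .
  show "B \<subseteq> E" using assms(2) p by (auto simp: B E_def)
  \<comment> \<open>One formula serves \<open>rank\<close> and \<open>weight\<close>; for i = 0 the
    new cell comes from the source and nothing is subtracted.\<close>
  have *: "(\<Sum>(i, j)\<in>B. f i) = f (Suc i) + ((\<Sum>(i, j)\<in>A. f i) - (if i = 0 then 0 else f i))"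
    for f :: "nat \<Rightarrow> 'b::ab_group_add"
  proof (cases "i = 0")
    case True
    then show ?thesis using A fin zero_notin[OF assms(2)] by (simp add: B)
  next
    case False
    then have "(i, j) \<in> A" using A by simp
    then show ?thesis using A fin False by (simp add: B sum_diff1)
  qed
  show "rank B = rank A + 1" by (simp add: rank_def *)
  show "weight A < weight B"
    using a_pos[OF p(2)] a_less[OF p(2), of i] p(3) by (simp add: weight_def *)
qed

lemma lower_Some:
  assumes "p \<in> G" "A \<subseteq> E" "lower p A = Some B"
  shows "B \<subseteq> E" "rank B = rank A - 1"
proof -
  obtain j i where p: "p = (j, i)" "j \<in> J" "i < n j" using assms(1) by (auto simp: G_def)
  have B: "B = (if i = 0 then id else insert (i, j)) (A - {(Suc i, j)})"
      and A: "(Suc i, j) \<in> A" "i = 0 \<or> (i, j) \<notin> A"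
    using assms(3) by (auto simp: lower_def p split: if_splits)
  show B_E: "B \<subseteq> E" using assms(2) p by (auto simp: B E_def)
  \<comment> \<open>Undoing the move reduces the rank claim to the one for
    \<open>raise\<close>.\<close>
  have "raise p B = Some A"
    using raise_lower[OF assms(2), of j i] A assms(3) by (simp add: p)
  from raise_Some(2)[OF assms(1) B_E this] show "rank B = rank A - 1" by simp
qed

section \<open>The operators on the free vector space over subsets\<close>

definition vec :: "(nat \<times> 'j) set option \<Rightarrow> (nat \<times> 'j) set \<Rightarrow>\<^sub>0 real" where
  "vec u = (case u of None \<Rightarrow> 0 | Some A \<Rightarrow> Poly_Mapping.single A 1)"

text \<open>Linear extension from the basis indexed by \<open>Pow E\<close>; coordinates at other
  sets are discarded, which makes it linear on the whole space.\<close>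

definition ext :: "((nat \<times> 'j) set \<Rightarrow> 'v) \<Rightarrow> ((nat \<times> 'j) set \<Rightarrow>\<^sub>0 real) \<Rightarrow> 'v::real_vector" where
  "ext g v = (\<Sum>A\<in>Pow E. Poly_Mapping.lookup v A *\<^sub>R g A)"

text \<open>The coefficients are determined by the commutator: the diagonal entry at $A$ must be
  $2 \sum i$ minus a constant, and telescoping down a column of height $n$ leaves $n(n+1) - i(i+1)$.\<close>

definition coeff :: "'j \<times> nat \<Rightarrow> real" where
  "coeff = (\<lambda>(j, i). (real (n j * (n j + 1)) - real (i * (i + 1))) / (if i = 0 then 2 else 1))"

definition Xop :: "((nat \<times> 'j) set \<Rightarrow>\<^sub>0 real) \<Rightarrow> (nat \<times> 'j) set \<Rightarrow>\<^sub>0 real" where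
  "Xop = ext (\<lambda>A. \<Sum>p\<in>G. vec (raise p A))"

definition Yop :: "((nat \<times> 'j) set \<Rightarrow>\<^sub>0 real) \<Rightarrow> (nat \<times> 'j) set \<Rightarrow>\<^sub>0 real" where
  "Yop = ext (\<lambda>A. \<Sum>p\<in>G. coeff p *\<^sub>R vec (lower p A))"

lemma linear_ext: "linear (ext g)"
  by (rule linearI)
     (simp_all add: ext_def lookup_add lookup_scaleR scaleR_left_distrib sum.distrib scaleR_sum_right)

lemma ext_vec: "A \<subseteq> E \<Longrightarrow> ext g (vec (Some A)) = g A"
  using finite_E
  by (simp add: ext_def vec_def lookup_single when_def if_distrib[of "\<lambda>r. r *\<^sub>R _"] cong: if_cong)

lemma vec_None [simp]: "vec None = 0"
  by (simp add: vec_def)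

lemma lookup_vec_Some: "Poly_Mapping.lookup (vec (Some A)) B = (if A = B then 1 else 0)"
  by (simp add: vec_def lookup_single when_def)

lemma inj_vec_Some: "inj_on (\<lambda>A. vec (Some A)) P"
  by (rule inj_onI) (metis lookup_vec_Some zero_neq_one)

lemma independent_vec: "finite P \<Longrightarrow> independent ((\<lambda>A. vec (Some A)) ` P)"
proof (rule independent_if_scalars_zero)
  fix f x
  assume P: "finite P" and "(\<Sum>x\<in>(\<lambda>A. vec (Some A)) ` P. f x *\<^sub>R x) = 0"
    and x: "x \<in> (\<lambda>A. vec (Some A)) ` P"
  then have 0: "(\<Sum>A\<in>P. f (vec (Some A)) *\<^sub>R vec (Some A)) = 0"
    by (simp add: sum.reindex[OF inj_vec_Some])
  obtain B where B: "B \<in> P" "x = vec (Some B)" using x by auto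
  have "(\<Sum>A\<in>P. f (vec (Some A)) * (if A = B then 1 else 0)) = 0"
    using arg_cong[OF 0, of "\<lambda>v. Poly_Mapping.lookup v B"] by (simp add: lookup_sum lookup_scaleR lookup_vec_Some)
  then show "f x = 0" using P B by (simp add: if_distrib[of "(*) _"] cong: if_cong)
qed simp

text \<open>Since \<open>vec\<close> sends a blocked move to 0, \<open>Option.bind\<close> expresses
  products of operators without case distinctions.\<close>

lemma Xop_vec:
  "u = None \<or> (\<exists>A \<subseteq> E. u = Some A) \<Longrightarrow> Xop (vec u) = (\<Sum>p\<in>G. vec (Option.bind u (raise p)))"
  by (auto simp: Xop_def ext_vec linear_0[OF linear_ext])

lemma Yop_vec:
  "u = None \<or> (\<exists>A \<subseteq> E. u = Some A) \<Longrightarrow>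
    Yop (vec u) = (\<Sum>p\<in>G. coeff p *\<^sub>R vec (Option.bind u (lower p)))"
  by (auto simp: Yop_def ext_vec linear_0[OF linear_ext])

lemma linear_Xop: "linear Xop" and linear_Yop: "linear Yop"
  unfolding Xop_def Yop_def by (rule linear_ext)+

text \<open>The rank of \<open>E\<close> itself. Ranks of subsets run from 0 to this number, which
  is the \<open>D\<close> of the abstract setting.\<close>

definition total :: int where
  "total = (\<Sum>j\<in>J. \<Sum>i=1..n j. int i)"

text \<open>Eigenvalue at \<open>A\<close> of the commutator of one raising move with its own
  lowering move. The source never empties or fills, so for i = 0 the value is 1 or -1.\<close>

definition cartan :: "'j \<times> nat \<Rightarrow> (nat \<times> 'j) set \<Rightarrow> real" where
  "cartan = (\<lambda>(j, i) A. of_bool ((Suc i, j) \<in> A) -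
     (if i = 0 then of_bool ((Suc 0, j) \<notin> A) else of_bool ((i, j) \<in> A)))"

lemma cartan_diagonal:
  assumes "A \<subseteq> E"
  shows "vec (Option.bind (lower p A) (raise p)) - vec (Option.bind (raise p A) (lower p))
    = cartan p A *\<^sub>R vec (Some A)"
  by (cases p) (auto simp: cartan_def raise_lower[OF assms] lower_raise[OF assms])

text \<open>Summation by parts turns the differences of i(i + 1) into 2i; the halved coefficient at
  i = 0 compensates for the jump from -1 to 1. \<open>C\<close> stays arbitrary so that the height
  can grow in the induction.\<close>

lemma column_sum:
  fixes x :: "nat \<Rightarrow> bool" and C :: real
  shows "(\<Sum>i<Suc k. (C - real (i * (i + 1))) / (if i = 0 then 2 else 1) *
      (of_bool (x (Suc i)) - (if i = 0 then of_bool (\<not> x (Suc 0)) else of_bool (x i))))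
    = 2 * (\<Sum>i=1..Suc k. real i * of_bool (x i))
      + (C - real (Suc k * (Suc k + 1))) * of_bool (x (Suc k)) - C / 2"
  by (induction k) (auto simp: field_simps)

lemma sum_columns: "(\<Sum>j\<in>J. \<Sum>i=1..n j. g i j) = (\<Sum>(i, j)\<in>E. g i j)"
proof -
  have "(\<Sum>j\<in>J. \<Sum>i=1..n j. g i j) = (\<Sum>(j, i)\<in>(SIGMA j:J. {1..n j}). g i j)"
    using finite_J by (intro sum.Sigma) auto
  also have "\<dots> = (\<Sum>(i, j)\<in>E. g i j)"
    unfolding E_eq by (subst sum.reindex) (auto simp: inj_on_def intro!: sum.cong)
  finally show ?thesis .
qed

lemma sum_coeff_cartan:
  assumes "A \<subseteq> E"
  shows "(\<Sum>p\<in>G. coeff p * cartan p A) = of_int (2 * rank A - total)"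
proof -
  have col: "(\<Sum>i<n j. coeff (j, i) * cartan (j, i) A) =
      2 * (\<Sum>i=1..n j. real i * of_bool ((i, j) \<in> A)) - (\<Sum>i=1..n j. real i)" for j
  proof (cases "n j")
    case 0
    then show ?thesis by simp
  next
    case (Suc k)
    have gauss: "(\<Sum>i=1..n j. real i) = real (n j * (n j + 1)) / 2"
      using double_gauss_sum_from_Suc_0[of "n j", where 'a = real] by (simp add: algebra_simps)
    \<comment> \<open>Choosing \<open>C\<close> as n(n + 1) for the height n of the column makes the
      boundary term vanish.\<close>
    have "(\<Sum>i<n j. coeff (j, i) * cartan (j, i) A) =
        2 * (\<Sum>i=1..n j. real i * of_bool ((i, j) \<in> A)) - real (n j * (n j + 1)) / 2"
      using column_sum[where k = k and C = "real (n j * (n j + 1))" and x = "\<lambda>i. (i, j) \<in> A"]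
      unfolding coeff_def cartan_def prod.case Suc
      by (simp only: diff_self mult_zero_left add_0_right)
    then show ?thesis unfolding gauss .
  qed
  have "(\<Sum>p\<in>G. coeff p * cartan p A) = (\<Sum>j\<in>J. \<Sum>i<n j. coeff (j, i) * cartan (j, i) A)"
    using finite_J by (simp add: G_def sum.Sigma case_prod_beta)
  also have "\<dots> = 2 * (\<Sum>j\<in>J. \<Sum>i=1..n j. real i * of_bool ((i, j) \<in> A)) - of_int total"
    by (simp add: col sum_subtractf sum_distrib_left total_def)
  also have "(\<Sum>j\<in>J. \<Sum>i=1..n j. real i * of_bool ((i, j) \<in> A)) =
      (\<Sum>(i, j)\<in>E. real i * of_bool ((i, j) \<in> A))"
    by (rule sum_columns)
  also have "\<dots> = (\<Sum>(i, j)\<in>A. real i)"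
    using finite_E assms by (intro sum.mono_neutral_cong_right) auto
  also have "\<dots> = of_int (rank A)" by (simp add: rank_def case_prod_beta)
  finally show ?thesis by simp
qed

text \<open>Pairs of distinct generators cancel by \<open>raise_lower_commute\<close>; the diagonal
  pairs add up to the scalar of \<open>sum_coeff_cartan\<close>.\<close>

lemma commutator_vec:
  assumes A: "A \<subseteq> E"
  shows "Xop (Yop (vec (Some A))) - Yop (Xop (vec (Some A)))
    = of_int (2 * rank A - total) *\<^sub>R vec (Some A)"
proof -
  \<comment> \<open>Moves stay inside \<open>E\<close>, so the second operator can be evaluated on
    each term.\<close>
  have low: "lower q A = None \<or> (\<exists>B \<subseteq> E. lower q A = Some B)" if "q \<in> G" for q
    using lower_Some(1)[OF that A] by (cases "lower q A") auto
  have up: "raise q A = None \<or> (\<exists>B \<subseteq> E. raise q A = Some B)" if "q \<in> G" for q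
    using raise_Some(1)[OF that A] by (cases "raise q A") auto
  have "Yop (vec (Some A)) = (\<Sum>q\<in>G. coeff q *\<^sub>R vec (lower q A))"
    using A by (subst Yop_vec) auto
  then have XY: "Xop (Yop (vec (Some A))) =
      (\<Sum>q\<in>G. \<Sum>p\<in>G. coeff q *\<^sub>R vec (Option.bind (lower q A) (raise p)))"
    using low
    by (simp add: linear_sum[OF linear_Xop] linear_scale[OF linear_Xop] Xop_vec scaleR_sum_right)
  have "Xop (vec (Some A)) = (\<Sum>p\<in>G. vec (raise p A))"
    using A by (subst Xop_vec) auto
  then have "Yop (Xop (vec (Some A))) =
      (\<Sum>p\<in>G. \<Sum>q\<in>G. coeff q *\<^sub>R vec (Option.bind (raise p A) (lower q)))"
    using up by (simp add: linear_sum[OF linear_Yop] Yop_vec)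
  also have "\<dots> = (\<Sum>q\<in>G. \<Sum>p\<in>G. coeff q *\<^sub>R vec (Option.bind (raise p A) (lower q)))"
    by (rule sum.swap)
  finally have "Xop (Yop (vec (Some A))) - Yop (Xop (vec (Some A))) =
      (\<Sum>q\<in>G. \<Sum>p\<in>G. coeff q *\<^sub>R (vec (Option.bind (lower q A) (raise p))
        - vec (Option.bind (raise p A) (lower q))))"
    unfolding XY by (simp add: sum_subtractf scaleR_diff_right)
  also have "\<dots> = (\<Sum>q\<in>G. \<Sum>p\<in>G. if p = q then (coeff q * cartan q A) *\<^sub>R vec (Some A) else 0)"
    by (intro sum.cong refl) (simp add: cartan_diagonal[OF A] raise_lower_commute[OF _ A])
  also have "\<dots> = (\<Sum>q\<in>G. coeff q * cartan q A) *\<^sub>R vec (Some A)"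
    using finite_G by (simp add: scaleR_sum_left)
  finally show ?thesis by (simp add: sum_coeff_cartan[OF A])
qed

sublocale ranked_sl2 "Pow E" "\<lambda>A. vec (Some A)" rank weight Xop Yop total
proof (rule ranked_sl2.intro)
  show "finite (Pow E)" using finite_E by simp
  show "inj_on (\<lambda>A. vec (Some A)) (Pow E)" by (rule inj_vec_Some)
  show "independent ((\<lambda>A. vec (Some A)) ` Pow E)" using finite_E by (intro independent_vec) simp
  show "linear Xop" "linear Yop" by (rule linear_Xop linear_Yop)+
  show "Xop (vec (Some A)) \<in> span ((\<lambda>A. vec (Some A)) ` {B \<in> Pow E. rank B = rank A + 1 \<and> weight A < weight B})"
    if "A \<in> Pow E" for A
  proof -
    have "vec (raise p A) \<in> span ((\<lambda>A. vec (Some A)) ` {B \<in> Pow E. rank B = rank A + 1 \<and> weight A < weight B})"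
      if "p \<in> G" for p
      using raise_Some[OF that _, of A] \<open>A \<in> Pow E\<close>
      by (cases "raise p A") (auto intro!: span_zero span_base)
    then show ?thesis using that by (subst Xop_vec) (auto intro!: span_sum)
  qed
  show "Yop (vec (Some A)) \<in> span ((\<lambda>A. vec (Some A)) ` {B \<in> Pow E. rank B = rank A - 1})"
    if "A \<in> Pow E" for A
  proof -
    have "vec (lower p A) \<in> span ((\<lambda>A. vec (Some A)) ` {B \<in> Pow E. rank B = rank A - 1})"
      if "p \<in> G" for p
      using lower_Some[OF that _, of A] \<open>A \<in> Pow E\<close>
      by (cases "lower p A") (auto intro!: span_zero span_base)
    then show ?thesis using that by (subst Yop_vec) (auto intro!: span_sum span_scale)
  qed
  show "Xop (Yop (vec (Some A))) - Yop (Xop (vec (Some A)))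
    = of_int (2 * rank A - total) *\<^sub>R vec (Some A)" if "A \<in> Pow E" for A
    using commutator_vec that by simp
qed

end

section \<open>Cutting the rows of the Young diagram into columns\<close>

lemma card_weight_levels_le:
  fixes N :: nat and a :: "nat \<Rightarrow> real" and m :: "nat \<Rightarrow> nat" and S :: "real set"
  assumes a1: "0 < a 1" and a: "strict_mono_on {1..N} a" and m: "antimono_on {1..N} m"
    and S: "finite S"
  defines "cells \<equiv> SIGMA i:{1..N}. {1..m i}"
  shows "\<exists>t. card {A \<in> Pow cells. (\<Sum>(i, j)\<in>A. a i) \<in> S}
    \<le> card {A \<in> Pow cells. (\<Sum>(i, j)\<in>A. int i) \<in> {t..<t + int (card S)}}"
proof -
  \<comment> \<open>The conjugate partition: column \<open>j\<close> meets the rows of length at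
    least \<open>j\<close>.\<close>
  define n where "n j = card {i \<in> {1..N}. j \<le> m i}" for j
  have n_le: "n j \<le> N" for j
    using card_mono[of "{1..N}" "{i \<in> {1..N}. j \<le> m i}"] unfolding n_def by (simp add: subset_iff)
  \<comment> \<open>Row lengths decrease, so with its last row a column meets all earlier
    rows.\<close>
  have column: "{i \<in> {1..N}. j \<le> m i} = {1..n j}" for j
  proof (cases "{i \<in> {1..N}. j \<le> m i} = {}")
    case True
    then show ?thesis by (simp add: n_def)
  next
    case False
    define k where "k = Max {i \<in> {1..N}. j \<le> m i}"
    have "k \<in> {i \<in> {1..N}. j \<le> m i}" unfolding k_def using False by (intro Max_in) auto
    moreover have "i \<le> k" if "i \<in> {i \<in> {1..N}. j \<le> m i}" for i
      unfolding k_def using that by (intro Max_ge) auto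
    ultimately have "{i \<in> {1..N}. j \<le> m i} = {1..k}"
      using monotone_onD[OF m, of _ k] by fastforce
    then show ?thesis by (simp add: n_def)
  qed
  interpret columns "{1..m 1}" n a
  proof
    show "0 < a 1" by (rule a1)
    show "a i < a (Suc i)" if "j \<in> {1..m 1}" "1 \<le> i" "i < n j" for i j
      using that n_le[of j] by (intro strict_mono_onD[OF a]) auto
  qed simp
  have "E = cells"
  proof -
    have "(i, j) \<in> E \<longleftrightarrow> (i, j) \<in> cells" for i j
    proof -
      have "i \<in> {1..n j} \<longleftrightarrow> i \<in> {1..N} \<and> j \<le> m i" using column[of j] by blast
      \<comment> \<open>Row 1 is the longest, so the columns \<open>{1..m 1}\<close> cover all
        cells.\<close>
      moreover have "m i \<le> m 1" if "i \<in> {1..N}" using monotone_onD[OF m, of 1 i] that by auto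
      moreover have "(i, j) \<in> E \<longleftrightarrow> j \<in> {1..m 1} \<and> i \<in> {1..n j}" unfolding E_def by auto
      moreover have "(i, j) \<in> cells \<longleftrightarrow> i \<in> {1..N} \<and> 1 \<le> j \<and> j \<le> m i" by (auto simp: cells_def)
      ultimately show ?thesis by (metis atLeastAtMost_iff le_trans)
    qed
    then show ?thesis by auto
  qed
  with card_levels_le_card_middle_ranks[OF S] show ?thesis
    by (simp only: weight_def rank_def)
qed

section \<open>Majorization\<close>

text \<open>The largest of k + 1 natural numbers is at least k, so its term is at most
  \<open>g k\<close>; remove it and induct.\<close>

lemma sum_le_sum_lessThan_card:
  fixes g :: "nat \<Rightarrow> real"
  assumes "finite I" "antimono g"
  shows "sum g I \<le> sum g {..<card I}"
  using assms(1)
proof (induction "card I" arbitrary: I)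
  case 0
  then show ?case by simp
next
  case (Suc k)
  define x where "x = Max I"
  have "I \<noteq> {}" using Suc.hyps(2) by auto
  then have x: "x \<in> I" using Suc.prems by (simp add: x_def)
  have "I \<subseteq> {..x}" using Suc.prems by (auto simp: x_def)
  then have "card I \<le> Suc x" using card_mono[of "{..x}" I] by simp
  then have "g x \<le> g k" using Suc.hyps(2) antimonoD[OF assms(2), of k x] by simp
  moreover have "sum g (I - {x}) \<le> sum g {..<k}"
    using Suc.hyps(1)[of "I - {x}"] Suc.hyps(2)[symmetric] Suc.prems x by simp
  ultimately show ?case
    using sum.remove[OF Suc.prems x, of g] by (simp flip: Suc.hyps(2))
qed

text \<open>Sorting support points by mass, rather than the masses themselves, remembers which
  points carry the largest masses.\<close>

lemma decreasing_masses_enumeration: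
  assumes "finite {x. prob_mass M X x \<noteq> 0}"
  shows "\<exists>xs. distinct xs \<and> set xs = {x. prob_mass M X x \<noteq> 0} \<and>
    decreasing_masses M X = map (prob_mass M X) xs"
proof -
  let ?f = "prob_mass M X"
  obtain ys where ys: "set ys = {x. ?f x \<noteq> 0}" "distinct ys"
    using finite_distinct_list[OF assms] by blast
  have "mset_set {x. ?f x \<noteq> 0} = mset ys" using ys mset_set_set by metis
  then have "decreasing_masses M X = rev (sorted_list_of_multiset (image_mset ?f (mset ys)))"
    by (simp add: decreasing_masses_def)
  also have "\<dots> = rev (sort (map ?f ys))"
    by (simp flip: mset_map)
  also have "sort (map ?f ys) = map ?f (sort_key ?f ys)"
    by (rule properties_for_sort) simp_all
  finally show ?thesis
    using ys by (intro exI[of _ "rev (sort_key ?f ys)"]) (simp add: rev_map)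
qed

lemma sum_nth_largest_mass:
  assumes "decreasing_masses M X = map (prob_mass M X) xs"
  shows "(\<Sum>i=1..k. nth_largest_mass M X i)
    = (\<Sum>i<k. if i < length xs then prob_mass M X (xs ! i) else 0)"
proof -
  have "(\<Sum>i=1..k. nth_largest_mass M X i) = (\<Sum>i<k. nth_largest_mass M X (Suc i))"
    by (rule sum.reindex_bij_witness[of _ Suc "\<lambda>i. i - 1"]) auto
  then show ?thesis using assms by (auto simp: nth_largest_mass_def intro!: sum.cong)
qed

text \<open>The first k points of the enumeration do it, or all of them if there are fewer. With the
  bound that follows, the partial sum is the maximal mass of at most k points.\<close>

lemma sum_nth_largest_mass_attained:
  assumes "finite {x. prob_mass M X x \<noteq> 0}"
  shows "\<exists>S. finite S \<and> card S \<le> k \<and> (\<Sum>i=1..k. nth_largest_mass M X i) = sum (prob_mass M X) S"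
proof -
  obtain xs where xs: "distinct xs" "decreasing_masses M X = map (prob_mass M X) xs"
    using decreasing_masses_enumeration[OF assms] by blast
  let ?I = "{i. i < k \<and> i < length xs}"
  have inj: "inj_on (nth xs) ?I" using xs(1) by (auto simp: inj_on_def nth_eq_iff_index_eq)
  have "(\<Sum>i=1..k. nth_largest_mass M X i) = (\<Sum>i\<in>?I. prob_mass M X (xs ! i))"
    unfolding sum_nth_largest_mass[OF xs(2)] by (intro sum.mono_neutral_cong_right) auto
  also have "\<dots> = sum (prob_mass M X) (nth xs ` ?I)"
    by (simp add: sum.reindex[OF inj])
  moreover have "card (nth xs ` ?I) \<le> k"
  proof -
    have "card ?I \<le> card {..<k}" by (intro card_mono) auto
    then show ?thesis using card_image_le[of ?I "nth xs"] by simp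
  qed
  ultimately show ?thesis by (intro exI[of _ "nth xs ` ?I"]) simp
qed

text \<open>Points of \<open>S\<close> in the support occupy at most k positions of the decreasing
  enumeration, and an initial segment of positions is the best choice.\<close>

lemma sum_le_sum_nth_largest_mass:
  assumes "finite {x. prob_mass M X x \<noteq> 0}" and S: "finite S" "card S \<le> k"
  shows "sum (prob_mass M X) S \<le> (\<Sum>i=1..k. nth_largest_mass M X i)"
proof -
  let ?f = "prob_mass M X"
  obtain xs where xs: "distinct xs" "set xs = {x. ?f x \<noteq> 0}" "decreasing_masses M X = map ?f xs"
    using decreasing_masses_enumeration[OF assms(1)] by blast
  define g where "g i = (if i < length xs then ?f (xs ! i) else 0)" for i
  have nonneg: "0 \<le> ?f x" for x by (simp add: prob_mass_def)
  have "sorted_wrt (\<ge>) (map ?f xs)"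
    unfolding xs(3)[symmetric] decreasing_masses_def by (simp add: sorted_wrt_rev)
  \<comment> \<open>Masses are nonnegative, so the zero padding preserves monotonicity.\<close>
  then have "antimono g"
    using nonneg by (auto simp: g_def monotone_def sorted_wrt_iff_nth_less le_less)
  define I where "I = {i. i < length xs \<and> xs ! i \<in> S}"
  have "finite I" by (simp add: I_def)
  have inj: "inj_on (nth xs) I" using xs(1) by (auto simp: inj_on_def nth_eq_iff_index_eq I_def)
  have image: "nth xs ` I = S \<inter> set xs" by (auto simp: I_def in_set_conv_nth)
  have "card I = card (S \<inter> set xs)" using card_image[OF inj] image by simp
  also have "\<dots> \<le> k" using card_mono[of S "S \<inter> set xs"] S by simp
  finally have "card I \<le> k" .
  have "sum ?f S = sum ?f (S \<inter> set xs)"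
    using S(1) xs(2) by (intro sum.mono_neutral_right) auto
  also have "\<dots> = sum g I"
    unfolding image[symmetric] sum.reindex[OF inj] by (intro sum.cong) (auto simp: g_def I_def)
  also have "\<dots> \<le> sum g {..<card I}"
    using \<open>finite I\<close> \<open>antimono g\<close> by (rule sum_le_sum_lessThan_card)
  also have "\<dots> \<le> sum g {..<k}"
    using \<open>card I \<le> k\<close> nonneg by (intro sum_mono2) (auto simp: g_def)
  finally show ?thesis unfolding sum_nth_largest_mass[OF xs(3)] g_def .
qed

lemma finite_nonzero_prob_mass:
  assumes "finitely_supported M X"
  shows "finite {x. prob_mass M X x \<noteq> 0}"
proof -
  obtain S where S: "finite S" "AE \<omega> in M. X \<omega> \<in> S"
    using assms by (auto simp: finitely_supported_def)
  have "prob_mass M X x = 0" if "x \<notin> S" for x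
  proof -
    have "AE \<omega> in M. X \<omega> \<noteq> x" using S(2) that by (auto elim!: eventually_mono)
    moreover have "{\<omega> \<in> space M. X \<omega> = x} \<in> sets M"
      using assms by (auto simp: finitely_supported_def)
    ultimately show ?thesis
      unfolding prob_mass_def by (subst (asm) AE_iff_measurable[OF _ refl]) (auto simp: measure_def)
  qed
  then show ?thesis using S(1) by (auto intro: finite_subset)
qed

text \<open>Replaces sorted masses by sets: partial sums are maxima over sets of bounded size, so it
  suffices to dominate each \<open>S\<close> by some \<open>S'\<close> that is no larger.\<close>

lemma majorizedI:
  assumes X: "finitely_supported M X" and Z: "finitely_supported M' Z"
    and le: "\<And>S. finite S \<Longrightarrow> \<exists>S'. finite S' \<and> card S' \<le> card S \<and>
      sum (prob_mass M X) S \<le> sum (prob_mass M' Z) S'"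
  shows "majorized M X M' Z"
  unfolding majorized_def
proof (intro conjI X Z allI impI)
  fix k :: nat
  obtain S where S: "finite S" "card S \<le> k"
      "(\<Sum>i=1..k. nth_largest_mass M X i) = sum (prob_mass M X) S"
    using sum_nth_largest_mass_attained[OF finite_nonzero_prob_mass[OF X]] by blast
  obtain S' where S': "finite S'" "card S' \<le> card S" "sum (prob_mass M X) S \<le> sum (prob_mass M' Z) S'"
    using le[OF S(1)] by blast
  show "(\<Sum>i=1..k. nth_largest_mass M X i) \<le> (\<Sum>i=1..k. nth_largest_mass M' Z i)"
    using sum_le_sum_nth_largest_mass[OF finite_nonzero_prob_mass[OF Z] S'(1), of k] S S' by simp
qed

section \<open>Combinations of independent binomial variables\<close>

text \<open>A subset of \<open>Sigma I B\<close> amounts to an independent choice of its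
  sections.\<close>

lemma card_subsets_with_section_cards:
  assumes "finite I" "\<And>i. i \<in> I \<Longrightarrow> finite (B i)"
  shows "card {A \<in> Pow (Sigma I B). \<forall>i\<in>I. card (A `` {i}) = y i} = (\<Prod>i\<in>I. card (B i) choose y i)"
proof -
  let ?T = "PiE I (\<lambda>i. {C. C \<subseteq> B i \<and> card C = y i})"
  have "bij_betw (\<lambda>A. \<lambda>i\<in>I. A `` {i}) {A \<in> Pow (Sigma I B). \<forall>i\<in>I. card (A `` {i}) = y i} ?T"
  proof (rule bij_betw_byWitness[where f' = "\<lambda>g. Sigma I g"])
    show "\<forall>A \<in> {A \<in> Pow (Sigma I B). \<forall>i\<in>I. card (A `` {i}) = y i}. Sigma I (\<lambda>i\<in>I. A `` {i}) = A"
      by auto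
    show "\<forall>g \<in> ?T. (\<lambda>i\<in>I. Sigma I g `` {i}) = g"
    proof
      fix g assume g: "g \<in> ?T"
      show "(\<lambda>i\<in>I. Sigma I g `` {i}) = g"
        by (rule extensionalityI[of _ I]) (use g in \<open>auto simp: PiE_def\<close>)
    qed
    show "(\<lambda>A. \<lambda>i\<in>I. A `` {i}) ` {A \<in> Pow (Sigma I B). \<forall>i\<in>I. card (A `` {i}) = y i} \<subseteq> ?T"
      by auto
    have "Sigma I g `` {i} = g i" if "i \<in> I" for g :: "'a \<Rightarrow> 'b set" and i using that by auto
    then show "Sigma I ` ?T \<subseteq> {A \<in> Pow (Sigma I B). \<forall>i\<in>I. card (A `` {i}) = y i}"
      by (auto dest: PiE_mem)
  qed
  then have "card {A \<in> Pow (Sigma I B). \<forall>i\<in>I. card (A `` {i}) = y i} = card ?T"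
    by (rule bij_betw_same_card)
  also have "\<dots> = (\<Prod>i\<in>I. card (B i) choose y i)"
    unfolding card_PiE[OF assms(1)] by (intro prod.cong refl n_subsets assms(2))
  finally show ?thesis .
qed

lemma sum_over_sections:
  fixes f :: "'a \<Rightarrow> 'c::comm_semiring_1"
  assumes "finite I" "finite A" "A \<subseteq> Sigma I B"
  shows "(\<Sum>(i, j)\<in>A. f i) = (\<Sum>i\<in>I. f i * of_nat (card (A `` {i})))"
proof -
  have "A = (SIGMA i:I. A `` {i})" using assms(3) by auto
  then have "(\<Sum>(i, j)\<in>A. f i) = (\<Sum>(i, j)\<in>(SIGMA i:I. A `` {i}). f i)" by simp
  also have "\<dots> = (\<Sum>i\<in>I. \<Sum>j\<in>A `` {i}. f i)"
    using assms by (intro sum.Sigma[symmetric]) auto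
  finally show ?thesis by (simp add: mult.commute)
qed

locale independent_binomials = prob_space M
  for M :: "'a measure" and N :: nat and m :: "nat \<Rightarrow> nat" and Y :: "nat \<Rightarrow> 'a \<Rightarrow> nat" +
  assumes N: "1 \<le> N"
    and indep: "indep_vars (\<lambda>_. count_space UNIV) Y {1..N}"
    and distr_Y: "i \<in> {1..N} \<Longrightarrow>
      distr M (count_space UNIV) (Y i) = measure_pmf (binomial_pmf (m i) (1/2))"
begin

text \<open>Row \<open>i\<close> stands for the \<open>m i\<close> fair coin tosses behind
  \<open>Y i\<close>; a subset of cells records the successes.\<close>

abbreviation cells :: "(nat \<times> nat) set" where
  "cells \<equiv> SIGMA i:{1..N}. {1..m i}"

lemma measurable_Y [measurable]: "i \<in> {1..N} \<Longrightarrow> Y i \<in> measurable M (count_space UNIV)"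
  using indep by (auto simp: indep_vars_def2)

lemma prob_Y:
  assumes "i \<in> {1..N}"
  shows "prob (Y i -` A \<inter> space M) = measure_pmf.prob (binomial_pmf (m i) (1/2)) A"
  using measure_distr[OF measurable_Y[OF assms], of A] by (simp add: distr_Y[OF assms])

lemma prob_Y_eq:
  assumes "i \<in> {1..N}"
  shows "prob (Y i -` {k} \<inter> space M) = real (m i choose k) / 2 ^ m i"
proof (cases "k \<le> m i")
  case True
  then have "(1/2 :: real) ^ k * (1/2) ^ (m i - k) = 1 / 2 ^ m i"
    by (simp add: power_divide flip: power_add)
  then show ?thesis
    using True by (simp add: prob_Y[OF assms] measure_pmf_single mult.assoc)
next
  case False
  then show ?thesis by (simp add: prob_Y[OF assms] measure_pmf_single binomial_eq_0)
qed

lemma AE_Y_le: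
  assumes "i \<in> {1..N}"
  shows "AE \<omega> in M. Y i \<omega> \<le> m i"
proof -
  have "AE k in distr M (count_space UNIV) (Y i). k \<le> m i"
    unfolding distr_Y[OF assms] by (auto simp: AE_measure_pmf_iff set_pmf_binomial_eq)
  then show ?thesis by (subst (asm) AE_distr_iff) (use assms in auto)
qed

text \<open>The binomial coefficients multiply to the number of subsets with the given row sizes,
  the powers of 2 to the number of all subsets.\<close>

lemma prob_joint:
  "prob (\<Inter>i\<in>{1..N}. Y i -` {y i} \<inter> space M) =
    card {A \<in> Pow cells. \<forall>i\<in>{1..N}. card (A `` {i}) = y i} / 2 ^ card cells"
proof -
  have "prob (\<Inter>i\<in>{1..N}. Y i -` {y i} \<inter> space M) = (\<Prod>i\<in>{1..N}. prob (Y i -` {y i} \<inter> space M))"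
    by (rule indep_varsD_finite[OF indep]) (use N in auto)
  also have "\<dots> = (\<Prod>i\<in>{1..N}. real (m i choose y i) / 2 ^ m i)"
    by (intro prod.cong refl prob_Y_eq)
  also have "\<dots> = real (\<Prod>i\<in>{1..N}. card {1..m i} choose y i) / 2 ^ card cells"
    by (simp add: prod_dividef power_sum)
  also have "(\<Prod>i\<in>{1..N}. card {1..m i} choose y i) =
      card {A \<in> Pow cells. \<forall>i\<in>{1..N}. card (A `` {i}) = y i}"
    by (rule card_subsets_with_section_cards[symmetric]) auto
  finally show ?thesis .
qed

context
  fixes f :: "nat \<Rightarrow> real"
begin

lemma measurable_combination [measurable]:
  "(\<lambda>\<omega>. \<Sum>i=1..N. f i * real (Y i \<omega>)) \<in> borel_measurable M"
proof (intro borel_measurable_sum borel_measurable_times borel_measurable_const)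
  fix i assume "i \<in> {1..N}"
  from measurable_compose[OF measurable_Y[OF this], of real borel]
  show "(\<lambda>\<omega>. real (Y i \<omega>)) \<in> borel_measurable M" by simp
qed

lemma AE_range:
  "AE \<omega> in M. (\<lambda>i\<in>{1..N}. Y i \<omega>) \<in> PiE {1..N} (\<lambda>i. {..m i})"
proof -
  have "AE \<omega> in M. \<forall>i\<in>{1..N}. Y i \<omega> \<le> m i"
    using AE_Y_le by (intro AE_finite_allI) auto
  then show ?thesis by eventually_elim auto
qed

lemma finitely_supported_combination:
  "finitely_supported M (\<lambda>\<omega>. \<Sum>i=1..N. f i * real (Y i \<omega>))"
  unfolding finitely_supported_def
proof (intro conjI measurable_combination exI)
  let ?V = "PiE {1..N} (\<lambda>i. {..m i})"
  show "finite ((\<lambda>y. \<Sum>i=1..N. f i * real (y i)) ` ?V)" by (intro finite_imageI finite_PiE) auto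
  show "AE \<omega> in M. (\<Sum>i=1..N. f i * real (Y i \<omega>)) \<in> (\<lambda>y. \<Sum>i=1..N. f i * real (y i)) ` ?V"
    using AE_range
  proof eventually_elim
    case (elim \<omega>)
    show ?case by (rule rev_image_eqI[OF elim]) simp
  qed
qed

text \<open>Both sides split along the vector \<open>y\<close> of values: the event into the
  \<open>Ev y\<close>, up to a null set, and the subsets into the \<open>C y\<close>.
  \<open>prob_joint\<close> matches the pieces.\<close>

lemma prob_mass_combination:
  "prob_mass M (\<lambda>\<omega>. \<Sum>i=1..N. f i * real (Y i \<omega>)) x =
    card {A \<in> Pow cells. (\<Sum>(i, j)\<in>A. f i) = x} / 2 ^ card cells"
proof -
  define V where "V = {y \<in> PiE {1..N} (\<lambda>i. {..m i}). (\<Sum>i=1..N. f i * real (y i)) = x}"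
  define Ev where "Ev y = (\<Inter>i\<in>{1..N}. Y i -` {y i} \<inter> space M)" for y
  define C where "C y = {A \<in> Pow cells. \<forall>i\<in>{1..N}. card (A `` {i}) = y i}" for y
  have "finite (PiE {1..N} (\<lambda>i. {..m i}))" by (intro finite_PiE) auto
  then have fin: "finite V" by (simp add: V_def)
  have Ev_iff: "\<omega> \<in> Ev y \<longleftrightarrow> \<omega> \<in> space M \<and> (\<lambda>i\<in>{1..N}. Y i \<omega>) = y" if "y \<in> V" for y \<omega>
  proof -
    have "y \<in> extensional {1..N}" using that by (auto simp: V_def PiE_def)
    then have "(\<lambda>i\<in>{1..N}. Y i \<omega>) = y \<longleftrightarrow> (\<forall>i\<in>{1..N}. Y i \<omega> = y i)"
      by (auto intro!: extensionalityI[of _ "{1..N}"])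
    \<comment> \<open>With N \<ge> 1 the intersection is nonempty and therefore contained in
      \<open>space M\<close>.\<close>
    then show ?thesis using N by (auto simp: Ev_def)
  qed
  have Ev_sets: "Ev y \<in> sets M" for y
    unfolding Ev_def using N measurable_sets[OF measurable_Y]
    by (intro sets.finite_INT) auto
  have disj: "disjoint_family_on Ev V"
    unfolding disjoint_family_on_def
  proof (intro ballI impI)
    fix y z assume "y \<in> V" "z \<in> V" "y \<noteq> z"
    then show "Ev y \<inter> Ev z = {}"
      using Ev_iff[of y] Ev_iff[of z] by (metis disjoint_iff)
  qed
  have "prob {\<omega> \<in> space M. (\<Sum>i=1..N. f i * real (Y i \<omega>)) = x} = prob (\<Union>y\<in>V. Ev y)"
  \<comment> \<open>Equality holds only almost surely, as \<open>Y i\<close> may exceed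
    \<open>m i\<close> on a null set.\<close>
  proof (rule measure_eq_AE)
    show "AE \<omega> in M. \<omega> \<in> {\<omega> \<in> space M. (\<Sum>i=1..N. f i * real (Y i \<omega>)) = x} \<longleftrightarrow> \<omega> \<in> (\<Union>y\<in>V. Ev y)"
      using AE_range AE_space
    proof eventually_elim
      case (elim \<omega>)
      have "(\<Sum>i=1..N. f i * real (Y i \<omega>)) = x \<longleftrightarrow> (\<lambda>i\<in>{1..N}. Y i \<omega>) \<in> V"
        using elim(1) by (simp add: V_def)
      moreover have "\<omega> \<in> (\<Union>y\<in>V. Ev y) \<longleftrightarrow> (\<lambda>i\<in>{1..N}. Y i \<omega>) \<in> V"
        using Ev_iff elim(2) by (metis UN_iff)
      ultimately show ?case using elim(2) by simp
    qed
    show "(\<Union>y\<in>V. Ev y) \<in> sets M" using fin Ev_sets by blast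
    show "{\<omega> \<in> space M. (\<Sum>i=1..N. f i * real (Y i \<omega>)) = x} \<in> sets M" by measurable
  qed
  also have "\<dots> = (\<Sum>y\<in>V. prob (Ev y))"
    using fin Ev_sets disj by (intro finite_measure_finite_Union) auto
  also have "\<dots> = real (\<Sum>y\<in>V. card (C y)) / 2 ^ card cells"
    by (simp only: Ev_def C_def prob_joint sum_divide_distrib of_nat_sum)
  also have "(\<Sum>y\<in>V. card (C y)) = card (\<Union>y\<in>V. C y)"
  proof (rule card_UN_disjoint[symmetric, OF fin])
    show "\<forall>y\<in>V. finite (C y)" by (simp add: C_def)
    \<comment> \<open>The row sizes of \<open>A\<close> determine \<open>y\<close>.\<close>
    have "y = z" if "y \<in> V" "z \<in> V" "A \<in> C y" "A \<in> C z" for y z A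
      using that by (intro extensionalityI[of _ "{1..N}"]) (auto simp: V_def C_def PiE_def)
    then show "\<forall>y\<in>V. \<forall>z\<in>V. y \<noteq> z \<longrightarrow> C y \<inter> C z = {}" by blast
  qed
  also have "(\<Union>y\<in>V. C y) = {A \<in> Pow cells. (\<Sum>(i, j)\<in>A. f i) = x}"
  proof -
    have "A \<in> (\<Union>y\<in>V. C y) \<longleftrightarrow> (\<Sum>(i, j)\<in>A. f i) = x" if A: "A \<subseteq> cells" for A
    proof -
      have "finite A" using A by (rule finite_subset) simp
      then have sum: "(\<Sum>(i, j)\<in>A. f i) = (\<Sum>i=1..N. f i * real (card (A `` {i})))"
        using A by (intro sum_over_sections) auto
      have "card (A `` {i}) \<le> m i" for i
        using card_mono[of "{1..m i}" "A `` {i}"] A by auto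
      then have "(\<lambda>i\<in>{1..N}. card (A `` {i})) \<in> V \<longleftrightarrow> (\<Sum>(i, j)\<in>A. f i) = x"
        by (simp add: V_def sum)
      moreover have "A \<in> C y \<longleftrightarrow> y = (\<lambda>i\<in>{1..N}. card (A `` {i}))" if "y \<in> V" for y
      proof -
        have "y \<in> extensional {1..N}" using that by (auto simp: V_def PiE_def)
        then have "y = (\<lambda>i\<in>{1..N}. card (A `` {i})) \<longleftrightarrow> (\<forall>i\<in>{1..N}. card (A `` {i}) = y i)"
          by (auto intro!: extensionalityI[of _ "{1..N}"])
        then show ?thesis using A by (simp add: C_def)
      qed
      ultimately show ?thesis by blast
    qed
    moreover have "(\<Union>y\<in>V. C y) \<subseteq> Pow cells" by (auto simp: C_def)
    ultimately show ?thesis by blast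
  qed
  finally show ?thesis by (simp add: prob_mass_def)
qed

lemma sum_prob_mass_combination:
  assumes "finite S"
  shows "sum (prob_mass M (\<lambda>\<omega>. \<Sum>i=1..N. f i * real (Y i \<omega>))) S =
    card {A \<in> Pow cells. (\<Sum>(i, j)\<in>A. f i) \<in> S} / 2 ^ card cells"
proof -
  have "(\<Sum>x\<in>S. card {A \<in> Pow cells. (\<Sum>(i, j)\<in>A. f i) = x}) =
      card (\<Union>x\<in>S. {A \<in> Pow cells. (\<Sum>(i, j)\<in>A. f i) = x})"
    using assms by (intro card_UN_disjoint[symmetric]) auto
  also have "(\<Union>x\<in>S. {A \<in> Pow cells. (\<Sum>(i, j)\<in>A. f i) = x}) = {A \<in> Pow cells. (\<Sum>(i, j)\<in>A. f i) \<in> S}"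
    by auto
  finally have "(\<Sum>x\<in>S. card {A \<in> Pow cells. (\<Sum>(i, j)\<in>A. f i) = x}) =
      card {A \<in> Pow cells. (\<Sum>(i, j)\<in>A. f i) \<in> S}" .
  then show ?thesis
    unfolding prob_mass_combination sum_divide_distrib[symmetric] of_nat_sum[symmetric] by (rule arg_cong)
qed

end

end

section \<open>From counting subsets to comparing mass functions\<close>

theorem theorem1p6:
  fixes N :: nat and a :: "nat \<Rightarrow> real" and m :: "nat \<Rightarrow> nat"
    and M :: "'a measure" and Y :: "nat \<Rightarrow> 'a \<Rightarrow> nat"
  assumes "1 \<le> N"
    and "0 < a 1" and "strict_mono_on {1..N} a"
    and "antimono_on {1..N} m" and "1 \<le> m N"
    and "prob_space M"
    and "prob_space.indep_vars M (\<lambda>_. count_space UNIV) Y {1..N}"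
    and "\<And>i. i \<in> {1..N} \<Longrightarrow>
           distr M (count_space UNIV) (Y i) = measure_pmf (binomial_pmf (m i) (1/2))"
  shows "majorized M (\<lambda>\<omega>. \<Sum>i=1..N. a i * real (Y i \<omega>))
                   M (\<lambda>\<omega>. \<Sum>i=1..N. real i * real (Y i \<omega>))"
proof -
  interpret prob_space M by fact
  interpret independent_binomials M N m Y
    by unfold_locales (use assms in auto)
  show ?thesis
  proof (rule majorizedI[OF finitely_supported_combination finitely_supported_combination])
    fix S :: "real set"
    assume S: "finite S"
    obtain t where t: "card {A \<in> Pow cells. (\<Sum>(i, j)\<in>A. a i) \<in> S}
        \<le> card {A \<in> Pow cells. (\<Sum>(i, j)\<in>A. int i) \<in> {t..<t + int (card S)}}"
      using card_weight_levels_le[OF assms(2,3,4) S] by blast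
    \<comment> \<open>The middle window of consecutive ranks, viewed as real values of the
      right-hand variable.\<close>
    define S' where "S' = real_of_int ` {t..<t + int (card S)}"
    have "(\<Sum>(i, j)\<in>A. real i) = of_int (\<Sum>(i, j)\<in>A. int i)" for A :: "(nat \<times> nat) set"
      by (simp add: case_prod_beta)
    then have "(\<Sum>(i, j)\<in>A. real i) \<in> S' \<longleftrightarrow> (\<Sum>(i, j)\<in>A. int i) \<in> {t..<t + int (card S)}"
      for A :: "(nat \<times> nat) set"
      unfolding S'_def by (simp only: inj_image_mem_iff[OF injI[of real_of_int]] of_int_eq_iff)
    with t have "card {A \<in> Pow cells. (\<Sum>(i, j)\<in>A. a i) \<in> S}
        \<le> card {A \<in> Pow cells. (\<Sum>(i, j)\<in>A. real i) \<in> S'}"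
      by (simp only:)
    moreover have S': "finite S'" "card S' \<le> card S"
      using card_image_le[of "{t..<t + int (card S)}" real_of_int] by (auto simp: S'_def)
    \<comment> \<open>Both masses are subset counts over the same denominator
      \<open>2 ^ card cells\<close>.\<close>
    ultimately have "sum (prob_mass M (\<lambda>\<omega>. \<Sum>i=1..N. a i * real (Y i \<omega>))) S
        \<le> sum (prob_mass M (\<lambda>\<omega>. \<Sum>i=1..N. real i * real (Y i \<omega>))) S'"
      unfolding sum_prob_mass_combination[OF S] sum_prob_mass_combination[OF S'(1)]
      by (intro divide_right_mono of_nat_mono) simp_all
    with S' show "\<exists>S'. finite S' \<and> card S' \<le> card S \<and>
        sum (prob_mass M (\<lambda>\<omega>. \<Sum>i=1..N. a i * real (Y i \<omega>))) S
        \<le> sum (prob_mass M (\<lambda>\<omega>. \<Sum>i=1..N. real i * real (Y i \<omega>))) S'"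
      by blast
  qed
qed

end
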